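(* Let $A\in\mathbb R^{m\times N}$, $b\in\mathbb R^m$, $E\in\mathbb R^{r\times N}$, let $\|\cdot\|_\star$ be a norm on $\mathbb R^r$ with dual norm $\|\cdot\|_\diamond$, and let $\mathcal C=\{x\in\mathbb R^N\mid Cx\le d\}$ be a nonempty polyhedral set, with $C\in\mathbb R^{\ell\times N}$, $d\in\mathbb R^\ell$. Let $(y_*,\mu_*,v_* )$ be an optimal solution of the dual problem $$\min_{y\in\mathbb R^m,\ \mu\in\mathbb R^\ell_+,\ \|v\|_\diamond\le1}\Big\{\tfrac12\|y\|_2^2+b^Ty+d^T\mu\ :\ A^Ty+E^Tv+C^T\mu=0\Big\}.$$ Then for any optimal solution $x_*$ of the primal LASSO-like problem $$\min_{x\in\mathcal C}\ \tfrac12\|Ax-b\|_2^2+\|Ex\|_\star,$$ one has $Ax_*-b=y_*$. Further, if $\mathcal C$ is a polyhedral cone (i.e., $d=0$), then $\|Ex_*\|_\star=-(b+y_* )^Ty_*$.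
   Context: The dual norm is $\|z\|_\diamond:=\sup\{z^Tv\mid\|v\|_\star\le1\}$, $z\in\mathbb R^r$. *)

theory Defs
  imports "HOL-Analysis.Analysis"
begin

text \<open>An arbitrary norm, as opposed to the fixed norm of the type class.\<close>

definition is_norm :: "('a::real_vector \<Rightarrow> real) \<Rightarrow> bool" where
  "is_norm \<nu> \<longleftrightarrow>
     (\<forall>x. 0 \<le> \<nu> x) \<and>
     (\<forall>x. \<nu> x = 0 \<longleftrightarrow> x = 0) \<and>
     (\<forall>c x. \<nu> (c *\<^sub>R x) = \<bar>c\<bar> * \<nu> x) \<and>
     (\<forall>x y. \<nu> (x + y) \<le> \<nu> x + \<nu> y)"

text \<open>The supremum is the real-valued one; when \<open>\<nu>\<close> is a norm in finite dimension, the set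
  is nonempty and bounded above.\<close>

definition dual_norm :: "('a::euclidean_space \<Rightarrow> real) \<Rightarrow> 'a \<Rightarrow> real" where
  "dual_norm \<nu> z = Sup {z \<bullet> v | v. \<nu> v \<le> 1}"

text \<open>The order on \<^typ>\<open>real ^ 'l\<close> is componentwise.\<close>

definition polyhedral_set :: "real ^ 'n ^ 'l \<Rightarrow> real ^ 'l \<Rightarrow> (real ^ 'n) set" where
  "polyhedral_set C d = {x. C *v x \<le> d}"

definition primal_obj ::
  "real ^ 'n ^ 'm \<Rightarrow> real ^ 'm \<Rightarrow> real ^ 'n ^ 'r \<Rightarrow> (real ^ 'r \<Rightarrow> real) \<Rightarrow> real ^ 'n \<Rightarrow> real" where
  "primal_obj A b E \<nu> x = 1/2 * (norm (A *v x - b))\<^sup>2 + \<nu> (E *v x)"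

definition primal_optimal ::
  "real ^ 'n ^ 'm \<Rightarrow> real ^ 'm \<Rightarrow> real ^ 'n ^ 'r \<Rightarrow> (real ^ 'r \<Rightarrow> real) \<Rightarrow>
   real ^ 'n ^ 'l \<Rightarrow> real ^ 'l \<Rightarrow> real ^ 'n \<Rightarrow> bool" where
  "primal_optimal A b E \<nu> C d x \<longleftrightarrow>
     is_arg_min (primal_obj A b E \<nu>) (\<lambda>x. x \<in> polyhedral_set C d) x"

definition dual_obj ::
  "real ^ 'm \<Rightarrow> real ^ 'l \<Rightarrow> (real ^ 'm) \<times> (real ^ 'l) \<times> (real ^ 'r) \<Rightarrow> real" where
  "dual_obj b d = (\<lambda>(y, \<mu>, v). 1/2 * (norm y)\<^sup>2 + b \<bullet> y + d \<bullet> \<mu>)"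

definition dual_feasible ::
  "real ^ 'n ^ 'm \<Rightarrow> real ^ 'n ^ 'r \<Rightarrow> (real ^ 'r \<Rightarrow> real) \<Rightarrow> real ^ 'n ^ 'l \<Rightarrow>
   (real ^ 'm) \<times> (real ^ 'l) \<times> (real ^ 'r) \<Rightarrow> bool" where
  "dual_feasible A E \<nu> C = (\<lambda>(y, \<mu>, v).
     0 \<le> \<mu> \<and> dual_norm \<nu> v \<le> 1 \<and>
     transpose A *v y + transpose E *v v + transpose C *v \<mu> = 0)"

definition dual_optimal ::
  "real ^ 'n ^ 'm \<Rightarrow> real ^ 'm \<Rightarrow> real ^ 'n ^ 'r \<Rightarrow> (real ^ 'r \<Rightarrow> real) \<Rightarrow>
   real ^ 'n ^ 'l \<Rightarrow> real ^ 'l \<Rightarrow> (real ^ 'm) \<times> (real ^ 'l) \<times> (real ^ 'r) \<Rightarrow> bool" where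
  "dual_optimal A b E \<nu> C d p \<longleftrightarrow>
     is_arg_min (dual_obj b d) (dual_feasible A E \<nu> C) p"

end

theory Submission
  imports Defs
begin

text \<open>Linearizing the quadratic term at a primal optimum \<open>x\<close> gives a problem whose objective is
  the linear form \<open>A\<^sup>T(Ax - b)\<close> plus the norm term. Its multipliers come from separating a point
  from the sum of a compact set (the image of the dual unit ball) and a finitely generated cone,
  which is closed and thus needs no constraint qualification. With these multipliers \<open>Ax - b\<close> is
  dual feasible and there is no duality gap. Since the dual objective exceeds the negated primal
  optimal value by at least \<open>\<parallel>y - (Ax - b)\<parallel>\<^sup>2/2\<close> at every feasible \<open>(y, \<mu>, v)\<close>, a dual optimum
  must have \<open>y = Ax - b\<close>.\<close>

section \<open>Matrix adjoints, and linear images of the orthant\<close>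

lemma transpose_matrix_inner:
  fixes M :: "real ^ 'n ^ 'm"
  shows "(transpose M *v u) \<bullet> x = u \<bullet> (M *v x)"
  by (metis dot_lmul_matrix transpose_matrix_vector)

lemma inner_mono_vec:
  fixes u v w :: "real ^ 'n"
  assumes "0 \<le> u" "v \<le> w"
  shows "u \<bullet> v \<le> u \<bullet> w"
  using assms unfolding inner_vec_def less_eq_vec_def
  by (auto intro!: sum_mono mult_left_mono)

lemma convex_cone_sum:
  assumes S: "convex_cone S" and "\<And>i. i \<in> I \<Longrightarrow> f i \<in> S"
  shows "sum f I \<in> S"
  using assms(2)
proof (induction I rule: infinite_finite_induct)
  case (infinite I)
  then show ?case using S by (simp add: convex_cone_contains_0)
next
  case empty
  then show ?case using S by (simp add: convex_cone_contains_0)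
next
  case (insert i I)
  then show ?case using S by (simp add: convex_cone_add)
qed

lemma convex_cone_hull_Basis:
  "convex_cone hull (Basis :: 'a::euclidean_space set) = {p. \<forall>i\<in>Basis. 0 \<le> p \<bullet> i}"
proof
  show "convex_cone hull (Basis :: 'a set) \<subseteq> {p. \<forall>i\<in>Basis. 0 \<le> p \<bullet> i}"
  proof (rule hull_minimal)
    show "(Basis :: 'a set) \<subseteq> {p. \<forall>i\<in>Basis. 0 \<le> p \<bullet> i}"
      by (auto simp: inner_Basis)
    show "convex_cone {p :: 'a. \<forall>i\<in>Basis. 0 \<le> p \<bullet> i}"
      unfolding convex_cone_iff by (auto simp: inner_add_left)
  qed
  show "{p. \<forall>i\<in>Basis. 0 \<le> p \<bullet> i} \<subseteq> convex_cone hull (Basis :: 'a set)"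
  proof
    fix p :: 'a
    assume "p \<in> {p. \<forall>i\<in>Basis. 0 \<le> p \<bullet> i}"
    then have "(\<Sum>i\<in>Basis. (p \<bullet> i) *\<^sub>R i) \<in> convex_cone hull Basis"
      by (intro convex_cone_sum convex_cone_convex_cone_hull)
        (auto intro: convex_cone_hull_mul hull_inc)
    then show "p \<in> convex_cone hull Basis"
      by (simp add: euclidean_representation)
  qed
qed

text \<open>Linear images of closed cones can fail to be closed. This one is generated by the
  finitely many images of basis vectors, and finitely generated cones are closed.\<close>

lemma linear_image_orthant:
  fixes f :: "'a::euclidean_space \<Rightarrow> 'b::euclidean_space"
  assumes "linear f"
  shows "closed (f ` {p. \<forall>i\<in>Basis. 0 \<le> p \<bullet> i})"
    and "convex (f ` {p. \<forall>i\<in>Basis. 0 \<le> p \<bullet> i})"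
proof -
  have eq: "f ` {p. \<forall>i\<in>Basis. 0 \<le> p \<bullet> i} = convex_cone hull (f ` Basis)"
    using assms by (simp add: convex_cone_hull_linear_image convex_cone_hull_Basis)
  show "closed (f ` {p. \<forall>i\<in>Basis. 0 \<le> p \<bullet> i})"
    unfolding eq by (simp add: closed_convex_cone_hull)
  show "convex (f ` {p. \<forall>i\<in>Basis. 0 \<le> p \<bullet> i})"
    unfolding eq by (rule convex_convex_cone_hull)
qed

section \<open>Arbitrary norms on a Euclidean space and their dual unit balls\<close>

context
  fixes \<nu> :: "'a::euclidean_space \<Rightarrow> real"
  assumes \<nu>: "is_norm \<nu>"
begin

lemma is_norm_nonneg: "0 \<le> \<nu> x"
  and is_norm_eq_0_iff: "\<nu> x = 0 \<longleftrightarrow> x = 0"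
  and is_norm_scaleR: "\<nu> (c *\<^sub>R x) = \<bar>c\<bar> * \<nu> x"
  and is_norm_triangle: "\<nu> (x + y) \<le> \<nu> x + \<nu> y"
  using \<nu> unfolding is_norm_def by blast+

lemma is_norm_convex: "convex_on UNIV \<nu>"
proof (rule convex_onI)
  fix t :: real and x y :: 'a
  assume "0 < t" "t < 1"
  then show "\<nu> ((1 - t) *\<^sub>R x + t *\<^sub>R y) \<le> (1 - t) * \<nu> x + t * \<nu> y"
    using is_norm_triangle[of "(1 - t) *\<^sub>R x" "t *\<^sub>R y"] by (simp add: is_norm_scaleR)
qed simp

text \<open>A finite convex function on the whole finite-dimensional space is continuous. The
  comparisons with the Euclidean norm then follow by compactness of the sphere and
  homogeneity.\<close>

lemma is_norm_continuous: "continuous_on S \<nu>"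
  using convex_on_continuous[OF open_UNIV is_norm_convex] continuous_on_subset by blast

lemma is_norm_on_sphere: "\<nu> x = norm x * \<nu> (x /\<^sub>R norm x)"
  by (cases "x = 0") (auto simp: is_norm_scaleR is_norm_eq_0_iff)

lemma is_norm_lower_bound:
  obtains k where "0 < k" "\<And>x. k * norm x \<le> \<nu> x"
proof -
  obtain z where z: "z \<in> sphere 0 1" "\<And>x. x \<in> sphere 0 1 \<Longrightarrow> \<nu> z \<le> \<nu> x"
    using continuous_attains_inf[of "sphere (0::'a) 1" \<nu>] is_norm_continuous
    by (auto simp del: mem_sphere_0)
  have "z \<noteq> 0"
    using z(1) by auto
  then have "0 < \<nu> z"
    using is_norm_nonneg[of z] is_norm_eq_0_iff[of z] by linarith
  moreover have "\<nu> z * norm x \<le> \<nu> x" for x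
  proof (cases "x = 0")
    case False
    then have "\<nu> z \<le> \<nu> (x /\<^sub>R norm x)"
      by (intro z(2)) simp
    then show ?thesis
      by (metis is_norm_on_sphere mult.commute mult_left_mono norm_ge_zero)
  qed (simp add: is_norm_nonneg)
  ultimately show ?thesis
    using that by blast
qed

lemma is_norm_upper_bound:
  obtains K where "0 < K" "\<And>x. \<nu> x \<le> K * norm x"
proof -
  obtain z where z: "\<And>x. x \<in> sphere 0 1 \<Longrightarrow> \<nu> x \<le> \<nu> z"
    using continuous_attains_sup[of "sphere (0::'a) 1" \<nu>] is_norm_continuous
    by (metis compact_sphere sphere_eq_empty not_one_less_zero)
  \<comment> \<open>Adding 1 makes the constant positive, given only that \<open>\<nu> z\<close> is
    nonnegative.\<close>
  have "\<nu> x \<le> (\<nu> z + 1) * norm x" for x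
  proof (cases "x = 0")
    case False
    then have "\<nu> (x /\<^sub>R norm x) \<le> \<nu> z + 1"
      using z[of "x /\<^sub>R norm x"] by simp
    then show ?thesis
      by (metis is_norm_on_sphere mult.commute mult_left_mono norm_ge_zero)
  qed (use is_norm_eq_0_iff[of 0] in simp)
  then show ?thesis
    using that[of "\<nu> z + 1"] is_norm_nonneg[of z] by simp
qed

text \<open>Homogeneity turns the supremum over the unit ball into a family of linear inequalities
  in \<open>v\<close>; all later arguments use this form of the dual ball.\<close>

lemma dual_norm_le_1_iff: "dual_norm \<nu> v \<le> 1 \<longleftrightarrow> (\<forall>u. v \<bullet> u \<le> \<nu> u)"
proof
  assume le: "\<forall>u. v \<bullet> u \<le> \<nu> u"
  show "dual_norm \<nu> v \<le> 1"
    unfolding dual_norm_def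
  proof (rule cSup_least)
    show "{v \<bullet> u | u. \<nu> u \<le> 1} \<noteq> {}"
      using is_norm_eq_0_iff[of 0] by (metis (mono_tags, lifting) empty_Collect_eq zero_le_one)
    show "s \<le> 1" if "s \<in> {v \<bullet> u | u. \<nu> u \<le> 1}" for s
      using that le by (auto intro: order_trans)
  qed
next
  assume le: "dual_norm \<nu> v \<le> 1"
  obtain k where k: "0 < k" "\<And>x. k * norm x \<le> \<nu> x"
    using is_norm_lower_bound by blast
  \<comment> \<open>The real \<open>Sup\<close> bounds its elements only if the set is bounded
    above; here this holds because \<open>\<nu>\<close> dominates a multiple of the Euclidean
    norm.\<close>
  have bdd: "bdd_above {v \<bullet> u | u. \<nu> u \<le> 1}"
  proof (rule bdd_aboveI)
    fix s assume "s \<in> {v \<bullet> u | u. \<nu> u \<le> 1}"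
    then obtain u where u: "s = v \<bullet> u" "\<nu> u \<le> 1"
      by blast
    then have "norm u \<le> 1 / k"
      using k(2)[of u] k(1) by (simp add: field_simps)
    then have "norm v * norm u \<le> norm v * (1 / k)"
      by (intro mult_left_mono) auto
    then show "s \<le> norm v * (1 / k)"
      using norm_cauchy_schwarz[of v u] u by linarith
  qed
  show "\<forall>u. v \<bullet> u \<le> \<nu> u"
  proof
    fix u
    show "v \<bullet> u \<le> \<nu> u"
    proof (cases "u = 0")
      case False
      then have pos: "0 < \<nu> u"
        using is_norm_nonneg[of u] is_norm_eq_0_iff[of u] by linarith
      then have "v \<bullet> (u /\<^sub>R \<nu> u) \<le> dual_norm \<nu> v"
        unfolding dual_norm_def
        by (intro cSup_upper bdd CollectI exI[of _ "u /\<^sub>R \<nu> u"]) (simp add: is_norm_scaleR)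
      with le have "v \<bullet> (u /\<^sub>R \<nu> u) \<le> 1"
        by linarith
      then show ?thesis
        using pos by (simp add: field_simps)
    qed (simp add: is_norm_nonneg)
  qed
qed

text \<open>Writing the ball as an intersection of closed half-spaces yields both its convexity and
  its closedness.\<close>

lemma dual_ball_eq: "{v. dual_norm \<nu> v \<le> 1} = (\<Inter>u. {v. v \<bullet> u \<le> \<nu> u})"
  by (auto simp: dual_norm_le_1_iff)

lemma convex_dual_ball: "convex {v. dual_norm \<nu> v \<le> 1}"
  unfolding dual_ball_eq
  by (intro convex_INT ballI) (auto simp: convex_halfspace_le inner_commute)

lemma compact_dual_ball: "compact {v. dual_norm \<nu> v \<le> 1}"
proof -
  obtain K where K: "0 < K" "\<And>x. \<nu> x \<le> K * norm x"
    using is_norm_upper_bound by blast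
  have "norm v \<le> K" if "dual_norm \<nu> v \<le> 1" for v
  proof (cases "v = 0")
    case False
    \<comment> \<open>Test the inequality that characterizes the dual ball at
      \<open>u = v\<close>.\<close>
    have "norm v * norm v \<le> \<nu> v"
      using that by (metis dual_norm_le_1_iff norm_cauchy_schwarz_eq)
    also have "\<dots> \<le> K * norm v"
      by (rule K)
    finally show ?thesis
      using False by simp
  qed (use K in simp)
  then have "bounded {v. dual_norm \<nu> v \<le> 1}"
    by (auto simp: bounded_iff)
  moreover have "closed {v. dual_norm \<nu> v \<le> 1}"
    unfolding dual_ball_eq
    by (intro closed_INT ballI) (auto simp: closed_halfspace_le inner_commute)
  ultimately show ?thesis
    by (simp add: compact_eq_bounded_closed)
qed

text \<open>The unit ball is its own bipolar.\<close>

lemma is_norm_le_if_dual_bound: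
  assumes bound: "\<And>v. dual_norm \<nu> v \<le> 1 \<Longrightarrow> v \<bullet> u \<le> t"
  shows "\<nu> u \<le> t"
proof (rule ccontr)
  assume "\<not> \<nu> u \<le> t"
  then have t: "t < \<nu> u"
    by simp
  have "dual_norm \<nu> 0 \<le> 1"
    by (simp add: dual_norm_le_1_iff is_norm_nonneg)
  then have "0 \<le> t"
    using bound[of 0] by simp
  \<comment> \<open>Since \<open>t\<close> may be 0, the point \<open>u\<close> is separated from a
    ball of positive radius \<open>r\<close> strictly between \<open>t\<close> and
    \<open>\<nu> u\<close>.\<close>
  obtain r where r: "t < r" "r < \<nu> u"
    using t dense by blast
  then have "0 < r"
    using \<open>0 \<le> t\<close> by simp
  have "convex {w. \<nu> w \<le> r}"
  proof (rule convexI)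
    fix x y :: 'a and a c :: real
    assume h: "x \<in> {w. \<nu> w \<le> r}" "y \<in> {w. \<nu> w \<le> r}" "0 \<le> a" "0 \<le> c" "a + c = 1"
    have "\<nu> (a *\<^sub>R x + c *\<^sub>R y) \<le> a * \<nu> x + c * \<nu> y"
      using is_norm_triangle[of "a *\<^sub>R x" "c *\<^sub>R y"] h by (simp add: is_norm_scaleR)
    also have "\<dots> \<le> r"
      using h by (intro convex_bound_le) auto
    finally show "a *\<^sub>R x + c *\<^sub>R y \<in> {w. \<nu> w \<le> r}"
      by simp
  qed
  moreover have "closed {w. \<nu> w \<le> r}"
    by (intro closed_Collect_le is_norm_continuous continuous_on_const)
  ultimately obtain a \<beta> where a: "a \<bullet> u < \<beta>" "\<And>w. \<nu> w \<le> r \<Longrightarrow> \<beta> < a \<bullet> w"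
    using separating_hyperplane_closed_point[of "{w. \<nu> w \<le> r}" u] r by auto
  have "\<beta> < 0"
    using a(2)[of 0] \<open>0 < r\<close> is_norm_eq_0_iff[of 0] by simp
  \<comment> \<open>The factor \<open>r / \<beta>\<close> is negative, so it reverses the
    separation: \<open>v\<close> stays below \<open>r\<close> on the ball of radius \<open>r\<close>
    and exceeds \<open>r\<close> at \<open>u\<close>. By homogeneity \<open>v\<close> lies in the
    dual ball.\<close>
  define v where "v = (r / \<beta>) *\<^sub>R a"
  have "v \<bullet> w \<le> \<nu> w" for w
  proof (cases "w = 0")
    case False
    then have pos: "0 < \<nu> w"
      using is_norm_nonneg[of w] is_norm_eq_0_iff[of w] by linarith
    have "\<beta> < a \<bullet> ((r / \<nu> w) *\<^sub>R w)"
      using \<open>0 < r\<close> pos by (intro a(2)) (simp add: is_norm_scaleR)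
    then have "\<beta> * \<nu> w < r * (a \<bullet> w)"
      using pos by (simp add: field_simps)
    then show ?thesis
      using \<open>\<beta> < 0\<close> by (simp add: v_def field_simps)
  qed (simp add: is_norm_nonneg)
  then have "v \<bullet> u \<le> t"
    by (intro bound) (simp add: dual_norm_le_1_iff)
  moreover have "r < v \<bullet> u"
    using a(1) \<open>\<beta> < 0\<close> \<open>0 < r\<close> by (simp add: v_def field_simps)
  ultimately show False
    using r by simp
qed

end

section \<open>First-order optimality and multipliers for the primal problem\<close>

text \<open>A step of length \<open>t\<close> from \<open>x\<close> towards \<open>z\<close> changes
  the objective by at most \<open>t * D + t\<^sup>2 * Q / 2\<close>, where \<open>D\<close> is the
  change of the linearized objective from \<open>x\<close> to \<open>z\<close>. If
  \<open>D < 0\<close>, a short step would improve on the optimum.\<close>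

lemma primal_optimal_linearized:
  assumes \<nu>: "is_norm \<nu>" and opt: "primal_optimal A b E \<nu> C d x"
    and z: "C *v z \<le> d"
  shows "(A *v x - b) \<bullet> (A *v x) + \<nu> (E *v x) \<le> (A *v x - b) \<bullet> (A *v z) + \<nu> (E *v z)"
proof (rule ccontr)
  assume contra: "\<not> ?thesis"
  define y where "y = A *v x - b"
  define h where "h = A *v z - A *v x"
  define D where "D = y \<bullet> h + \<nu> (E *v z) - \<nu> (E *v x)"
  define Q where "Q = (norm h)\<^sup>2"
  have D: "D < 0"
    using contra by (simp add: D_def h_def y_def inner_diff_right)
  have Q: "0 \<le> Q"
    by (simp add: Q_def)
  \<comment> \<open>The bound by 1 keeps \<open>w\<close> on the segment from \<open>x\<close> to
    \<open>z\<close>. The denominator \<open>Q + 1\<close> is positive even if \<open>Q = 0\<close>,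
    and ensures \<open>t * Q < - D\<close>.\<close>
  define t where "t = min 1 (- D / (Q + 1))"
  have t: "0 < t" "t \<le> 1"
    using D Q by (auto simp: t_def divide_neg_pos)
  have "t * Q \<le> - D / (Q + 1) * Q"
    using Q by (intro mult_right_mono) (auto simp: t_def)
  also have "\<dots> < - D"
    using D Q by (simp add: field_simps)
  finally have "t * (D + t * Q) < 0"
    using t by (simp add: mult_pos_neg)
  then have neg: "t * D + t\<^sup>2 * Q < 0"
    by (simp add: algebra_simps power2_eq_square)
  define w where "w = (1 - t) *\<^sub>R x + t *\<^sub>R z"
  have x: "C *v x \<le> d"
    and min: "\<And>u. C *v u \<le> d \<Longrightarrow> primal_obj A b E \<nu> x \<le> primal_obj A b E \<nu> u"
    using opt unfolding primal_optimal_def is_arg_min_def polyhedral_set_def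
    by (auto simp: not_less)
  have "C *v w \<le> d"
    unfolding less_eq_vec_def
  proof
    fix i
    have "(1 - t) * (C *v x) $ i + t * (C *v z) $ i \<le> d $ i"
      using x z t by (intro convex_bound_le) (auto simp: less_eq_vec_def)
    then show "(C *v w) $ i \<le> d $ i"
      by (simp add: w_def matrix_vector_right_distrib matrix_vector_mult_scaleR)
  qed
  then have "primal_obj A b E \<nu> x \<le> primal_obj A b E \<nu> w"
    by (rule min)
  moreover have "A *v w - b = y + t *\<^sub>R h"
    by (simp add: w_def y_def h_def matrix_vector_right_distrib matrix_vector_mult_scaleR algebra_simps)
  then have "(norm (A *v w - b))\<^sup>2 = (norm y)\<^sup>2 + 2 * t * (y \<bullet> h) + t\<^sup>2 * Q"
    unfolding Q_def power2_norm_eq_inner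
    by (simp add: inner_add_left inner_add_right inner_commute algebra_simps power2_eq_square)
  moreover have "\<nu> (E *v w) \<le> (1 - t) * \<nu> (E *v x) + t * \<nu> (E *v z)"
    using convex_onD[OF is_norm_convex[OF \<nu>], of t "E *v x" "E *v z"] t
    by (simp add: w_def matrix_vector_right_distrib matrix_vector_mult_scaleR)
  ultimately have "0 \<le> t * D + t\<^sup>2 * Q / 2"
    by (simp add: primal_obj_def D_def y_def algebra_simps)
  moreover have "0 \<le> t\<^sup>2 * Q"
    using Q by simp
  ultimately show False
    using neg by linarith
qed

text \<open>The multipliers exist exactly when \<open>(- g, - c)\<close> lies in \<open>S\<close>,
  with \<open>c\<close> the optimal value. If it does not, a separating functional is a solution of
  the homogenized primal constraints whose value is too small.\<close>

lemma multipliers_exist: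
  fixes g x :: "real ^ 'n" and E :: "real ^ 'n ^ 'r" and C :: "real ^ 'n ^ 'l"
  assumes \<nu>: "is_norm \<nu>" and x: "C *v x \<le> d"
    and min: "\<And>z. C *v z \<le> d \<Longrightarrow> g \<bullet> x + \<nu> (E *v x) \<le> g \<bullet> z + \<nu> (E *v z)"
  obtains \<mu> v where "0 \<le> \<mu>" "dual_norm \<nu> v \<le> 1"
    "g + transpose E *v v + transpose C *v \<mu> = 0"
    "d \<bullet> \<mu> \<le> - (g \<bullet> x + \<nu> (E *v x))"
proof -
  define c where "c = g \<bullet> x + \<nu> (E *v x)"
  define V where "V = {v. dual_norm \<nu> v \<le> 1}"
  define e where "e = (\<lambda>v. (transpose E *v v, 0::real))"
  define P where "P = {p :: (real ^ 'l) \<times> real. \<forall>i\<in>Basis. 0 \<le> p \<bullet> i}"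
  \<comment> \<open>The second component of \<open>p\<close> is a nonnegative slack, so that the
    inequality on \<open>d \<bullet> \<mu>\<close> becomes an equation.\<close>
  define L where "L = (\<lambda>p :: (real ^ 'l) \<times> real. (transpose C *v fst p, d \<bullet> fst p + snd p))"
  define S where "S = (\<Union>p\<in>e ` V. \<Union>q\<in>L ` P. {p + q})"
  have P: "(\<mu>, s) \<in> P \<longleftrightarrow> 0 \<le> \<mu> \<and> 0 \<le> s" for \<mu> s
    by (auto simp: P_def Basis_prod_def Basis_vec_def inner_axis less_eq_vec_def)
  have e: "linear e"
    unfolding e_def by (intro linearI)
      (auto simp: matrix_vector_right_distrib matrix_vector_mult_scaleR)
  have L: "linear L"
    unfolding L_def by (intro linearI)
      (auto simp: matrix_vector_right_distrib matrix_vector_mult_scaleR inner_add_right algebra_simps)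
  have "compact (e ` V)"
    unfolding V_def
    by (intro compact_continuous_image linear_continuous_on linear_conv_bounded_linear[THEN iffD1] e compact_dual_ball \<nu>)
  moreover have "closed (L ` P)"
    unfolding P_def by (rule linear_image_orthant(1)[OF L])
  ultimately have "closed S"
    unfolding S_def by (rule compact_closed_sums)
  have "convex (L ` P)"
    unfolding P_def by (rule linear_image_orthant(2)[OF L])
  then have "convex S"
    unfolding S_def V_def
    by (rule convex_sums[OF convex_linear_image[OF e convex_dual_ball[OF \<nu>]]])
  have "(- g, - c) \<in> S"
  proof (rule ccontr)
    assume "(- g, - c) \<notin> S"
    then obtain a \<beta> where a: "a \<bullet> (- g, - c) < \<beta>" "\<And>p. p \<in> S \<Longrightarrow> \<beta> < a \<bullet> p"
      using separating_hyperplane_closed_point[OF \<open>convex S\<close> \<open>closed S\<close>] by blast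
    \<comment> \<open>With this sign, \<open>k\<close> and \<open>\<tau>\<close> will satisfy
      \<open>C *v k \<le> \<tau> *\<^sub>R d\<close> with value below
      \<open>\<tau> * c\<close>.\<close>
    define k where "k = - fst a"
    define \<tau> where "\<tau> = snd a"
    have a_eq: "a = (- k, \<tau>)"
      by (simp add: k_def \<tau>_def)
    have below: "k \<bullet> g - \<tau> * c < \<beta>"
      using a(1) by (simp add: a_eq)
    have above: "\<beta> < - (v \<bullet> (E *v k)) + (\<mu> \<bullet> (\<tau> *\<^sub>R d - C *v k) + \<tau> * s)"
      if "dual_norm \<nu> v \<le> 1" "0 \<le> \<mu>" "0 \<le> s" for v \<mu> s
    proof -
      have "e v + L (\<mu>, s) \<in> S"
        using that P[of \<mu> s] unfolding S_def V_def by blast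
      from a(2)[OF this] show ?thesis
        by (simp add: a_eq e_def L_def inner_add_right inner_commute[of k] transpose_matrix_inner
            inner_diff_right inner_commute[of d] algebra_simps del: transpose_matrix_vector)
    qed
    have zero: "dual_norm \<nu> 0 \<le> 1"
      using \<nu> by (simp add: dual_norm_le_1_iff is_norm_nonneg)
    \<comment> \<open>The cone variables \<open>s\<close> and \<open>\<mu>\<close> can be scaled up
      freely, so their coefficients in the separating inequality must be nonnegative. Apply this to
      \<open>s\<close> for \<open>\<tau>\<close>, and to each coordinate of \<open>\<mu>\<close> for
      \<open>C *v k\<close>.\<close>
    have scale: "0 \<le> r" if "\<And>n::real. 0 \<le> n \<Longrightarrow> \<beta> < n * r" for r
    proof (rule ccontr)
      assume "\<not> 0 \<le> r"
      then have "0 \<le> \<bar>\<beta>\<bar> / (- r)" "\<bar>\<beta>\<bar> / (- r) * r = - \<bar>\<beta>\<bar>"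
        by (auto simp: field_simps)
      with that[of "\<bar>\<beta>\<bar> / (- r)"] show False
        by linarith
    qed
    have \<tau>: "0 \<le> \<tau>"
      by (rule scale) (use above[OF zero, of 0] in \<open>simp add: mult.commute\<close>)
    have Ck: "C *v k \<le> \<tau> *\<^sub>R d"
      unfolding less_eq_vec_def
    proof
      fix i
      have "0 \<le> (\<tau> *\<^sub>R d - C *v k) $ i"
      proof (rule scale)
        fix n :: real assume "0 \<le> n"
        then have "0 \<le> (axis i n :: real ^ 'l)"
          by (auto simp: less_eq_vec_def axis_def)
        from above[OF zero this, of 0] show "\<beta> < n * (\<tau> *\<^sub>R d - C *v k) $ i"
          by (simp add: inner_axis')
      qed
      then show "(C *v k) $ i \<le> (\<tau> *\<^sub>R d) $ i"
        by simp
    qed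
    \<comment> \<open>With \<open>\<mu> = 0\<close> and \<open>s = 0\<close> the separation bounds
      \<open>v \<bullet> (E *v k)\<close> by \<open>- \<beta>\<close> over the dual ball; bipolarity
      transfers the bound to the norm.\<close>
    have "\<nu> (E *v k) \<le> - \<beta>"
      by (rule is_norm_le_if_dual_bound[OF \<nu>]) (use above[of _ 0 0] in force)
    with below have neg: "g \<bullet> k + \<nu> (E *v k) < \<tau> * c"
      by (simp add: inner_commute)
    show False
    proof (cases "\<tau> = 0")
      case True
      \<comment> \<open>Here \<open>k\<close> is a recession direction of the feasible set with
        negative value, so \<open>x + k\<close> would improve on \<open>x\<close>.\<close>
      have "C *v (x + k) \<le> d"
        using add_mono[OF x Ck] True by (simp add: matrix_vector_right_distrib)
      from min[OF this] have "c \<le> g \<bullet> x + g \<bullet> k + \<nu> (E *v x + E *v k)"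
        by (simp add: c_def inner_add_right matrix_vector_right_distrib)
      then show False
        using neg True is_norm_triangle[OF \<nu>, of "E *v x" "E *v k"] by (simp add: c_def)
    next
      case False
      with \<tau> have pos: "0 < \<tau>"
        by simp
      \<comment> \<open>Rescaling gives a feasible point whose value is below
        \<open>c\<close>.\<close>
      have "C *v (k /\<^sub>R \<tau>) \<le> d"
        using Ck pos by (auto simp: matrix_vector_mult_scaleR less_eq_vec_def field_simps)
      from min[OF this] have "c \<le> (g \<bullet> k + \<nu> (E *v k)) / \<tau>"
        using pos by (simp add: c_def matrix_vector_mult_scaleR is_norm_scaleR[OF \<nu>] field_simps)
      then show False
        using neg pos by (simp add: field_simps)
    qed
  qed
  then obtain v \<mu> s where *: "dual_norm \<nu> v \<le> 1" "0 \<le> \<mu>" "0 \<le> s"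
      "(- g, - c) = e v + L (\<mu>, s)"
    unfolding S_def V_def by (auto simp: P)
  show ?thesis
  proof (rule that)
    have "- g = transpose E *v v + transpose C *v \<mu>"
      using *(4) by (simp add: e_def L_def)
    then show "g + transpose E *v v + transpose C *v \<mu> = 0"
      by (metis add.assoc add.right_inverse)
    show "d \<bullet> \<mu> \<le> - (g \<bullet> x + \<nu> (E *v x))"
      using * by (simp add: e_def L_def c_def)
  qed (use * in auto)
qed

section \<open>Weak duality and identification of the dual optimum\<close>

text \<open>Completing the square in \<open>y\<close> leaves the excess \<open>(\<nu> (E *v x) - v
  \<bullet> (E *v x)) + \<mu> \<bullet> (d - C *v x)\<close>, by the dual equality constraint paired
  with \<open>x\<close>. Both summands are nonnegative.\<close>

lemma dual_obj_lower_bound: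
  assumes \<nu>: "is_norm \<nu>" and x: "C *v x \<le> d"
    and feas: "dual_feasible A E \<nu> C (y, \<mu>, v)"
  shows "1/2 * (norm (y - (A *v x - b)))\<^sup>2 - primal_obj A b E \<nu> x \<le> dual_obj b d (y, \<mu>, v)"
proof -
  have f: "0 \<le> \<mu>" "dual_norm \<nu> v \<le> 1"
    "transpose A *v y + transpose E *v v + transpose C *v \<mu> = 0"
    using feas by (auto simp: dual_feasible_def)
  have "(transpose A *v y + transpose E *v v + transpose C *v \<mu>) \<bullet> x = 0"
    unfolding f(3) by simp
  then have "y \<bullet> (A *v x) + v \<bullet> (E *v x) + \<mu> \<bullet> (C *v x) = 0"
    by (simp only: inner_add_left transpose_matrix_inner)
  moreover have "v \<bullet> (E *v x) \<le> \<nu> (E *v x)"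
    using f(2) dual_norm_le_1_iff[OF \<nu>] by blast
  moreover have "\<mu> \<bullet> (C *v x) \<le> \<mu> \<bullet> d"
    by (rule inner_mono_vec[OF f(1) x])
  moreover have "(norm (y - (A *v x - b)))\<^sup>2
      = (norm y)\<^sup>2 - 2 * (y \<bullet> (A *v x)) + 2 * (b \<bullet> y) + (norm (A *v x - b))\<^sup>2"
    unfolding power2_norm_eq_inner
    by (simp add: inner_diff_left inner_diff_right inner_commute)
  ultimately show ?thesis
    by (simp add: dual_obj_def primal_obj_def inner_commute[of d] field_simps)
qed

theorem lemma4p2:
  fixes A :: "real ^ 'n ^ 'm" and b :: "real ^ 'm"
    and E :: "real ^ 'n ^ 'r" and \<nu> :: "real ^ 'r \<Rightarrow> real"
    and C :: "real ^ 'n ^ 'l" and d :: "real ^ 'l"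
    and y\<^sub>s :: "real ^ 'm" and \<mu>\<^sub>s :: "real ^ 'l" and v\<^sub>s :: "real ^ 'r"
  assumes "is_norm \<nu>"
    and "polyhedral_set C d \<noteq> {}"
    and "dual_optimal A b E \<nu> C d (y\<^sub>s, \<mu>\<^sub>s, v\<^sub>s)"
  shows "\<forall>x\<^sub>s. primal_optimal A b E \<nu> C d x\<^sub>s \<longrightarrow>
           A *v x\<^sub>s - b = y\<^sub>s \<and>
           (d = 0 \<longrightarrow> \<nu> (E *v x\<^sub>s) = - ((b + y\<^sub>s) \<bullet> y\<^sub>s))"
proof (intro allI impI)
  fix x
  assume opt: "primal_optimal A b E \<nu> C d x"
  define y where "y = A *v x - b"
  have x: "C *v x \<le> d"
    using opt by (simp add: primal_optimal_def is_arg_min_def polyhedral_set_def)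
  have feas\<^sub>s: "dual_feasible A E \<nu> C (y\<^sub>s, \<mu>\<^sub>s, v\<^sub>s)"
    and opt\<^sub>s: "\<And>p. dual_feasible A E \<nu> C p \<Longrightarrow> dual_obj b d (y\<^sub>s, \<mu>\<^sub>s, v\<^sub>s) \<le> dual_obj b d p"
    using assms(3) by (auto simp: dual_optimal_def is_arg_min_def not_less)
  \<comment> \<open>Taking \<open>transpose A *v y\<close> for \<open>g\<close> makes the multiplier
    equation the equality constraint of the dual.\<close>
  obtain \<mu> v where m: "0 \<le> \<mu>" "dual_norm \<nu> v \<le> 1"
      "transpose A *v y + transpose E *v v + transpose C *v \<mu> = 0"
      "d \<bullet> \<mu> \<le> - ((transpose A *v y) \<bullet> x + \<nu> (E *v x))"
    using multipliers_exist[OF assms(1) x, of "transpose A *v y"]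
      primal_optimal_linearized[OF assms(1) opt]
    by (metis transpose_matrix_inner y_def)
  have "dual_feasible A E \<nu> C (y, \<mu>, v)"
    using m by (simp add: dual_feasible_def)
  from opt\<^sub>s[OF this]
  have "dual_obj b d (y\<^sub>s, \<mu>\<^sub>s, v\<^sub>s) \<le> 1/2 * (norm y)\<^sup>2 + b \<bullet> y - y \<bullet> (A *v x) - \<nu> (E *v x)"
    using m(4) unfolding transpose_matrix_inner by (simp add: dual_obj_def)
  also have "\<dots> = - primal_obj A b E \<nu> x"
    unfolding primal_obj_def y_def power2_norm_eq_inner
    by (simp add: inner_diff_left inner_diff_right inner_commute algebra_simps)
  finally have upper: "dual_obj b d (y\<^sub>s, \<mu>\<^sub>s, v\<^sub>s) \<le> - primal_obj A b E \<nu> x" .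
  have lower: "1/2 * (norm (y\<^sub>s - y))\<^sup>2 - primal_obj A b E \<nu> x \<le> dual_obj b d (y\<^sub>s, \<mu>\<^sub>s, v\<^sub>s)"
    unfolding y_def by (rule dual_obj_lower_bound[OF assms(1) x feas\<^sub>s])
  have "(norm (y\<^sub>s - y))\<^sup>2 \<le> 0"
    using upper lower by linarith
  then have eq: "y = y\<^sub>s"
    by simp
  have "dual_obj b d (y\<^sub>s, \<mu>\<^sub>s, v\<^sub>s) = - primal_obj A b E \<nu> x"
    using upper lower eq by simp
  \<comment> \<open>For \<open>d = 0\<close> the term in \<open>\<mu>\<^sub>s\<close> vanishes, and
    equality of the two values, with \<open>A *v x - b = y\<^sub>s\<close>, can be solved for the
    norm term.\<close>
  then have "\<nu> (E *v x) = - ((b + y\<^sub>s) \<bullet> y\<^sub>s)" if "d = 0"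
    using that eq
    by (simp add: dual_obj_def primal_obj_def y_def power2_norm_eq_inner inner_add_left)
  with eq show "A *v x - b = y\<^sub>s \<and> (d = 0 \<longrightarrow> \<nu> (E *v x) = - ((b + y\<^sub>s) \<bullet> y\<^sub>s))"
    by (simp add: y_def)
qed

end
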